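(* Let $G=(V,E)$ be a cycle-disjoint directed graph. For $\Lambda\in\mathbb R^E$ and a noise vector $\varepsilon$, let $S=(s_{ij})$ and $T=(t_{ijk})$ be the second- and third-order moments of $X=(I-\Lambda)^{-T}\varepsilon$, and put $$d_{uv}^{2\times 2}=\det\begin{pmatrix}s_{uu}&s_{uv}\\ t_{uuu}&t_{uuv}\end{pmatrix},\qquad d_{uv}^{3\times 3}=\det\begin{pmatrix}s_{uu}&s_{uv}&s_{vv}\\t_{uuu}&t_{uuv}&t_{uvv}\\t_{uuv}&t_{uvv}&t_{vvv}\end{pmatrix}.$$ Let $\mathcal C$ be the collection of all (inclusion-)maximal subsets $C\subseteq V$ such that for all distinct $u,v\in C$, $d_{uv}^{3\times3}=0$ identically but $d_{uv}^{2\times2}$ is not identically zero. Then $\mathcal C$ contains (the vertex sets of) all root cycles of $G$. Here "identically" means for every choice of $\Lambda\in\mathbb R^E$ and every distribution of the noise vector $\varepsilon$.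
   Context: Directed graphs are finite and without self-loops. A directed graph is cycle-disjoint if each of its nodes belongs to at most one directed cycle (2-cycles are allowed). $\mathbb R^E$ is the set of real $|V|\times|V|$ matrices $\Lambda=(\lambda_{ij})$ with $I-\Lambda$ invertible and $\lambda_{ij}=0$ whenever $i\to j\notin E$. A noise vector $\varepsilon=(\varepsilon_i)_{i\in V}$ is a centered random vector with independent components, positive variances and finite third moments. For $X=(I-\Lambda)^{-T}\varepsilon$, where $M^{-T}=(M^{-1})^T$, set $s_{ij}=\mathbb E[X_iX_j]$ and $t_{ijk}=\mathbb E[X_iX_jX_k]$. For $C\subseteq V$, $\mathrm{anc}(C)$ is the set of all nodes having a directed path (of length at least $0$) to some node of $C$; $C$ is ancestral if $\mathrm{anc}(C)=C$. A root cycle is a directed cycle of $G$ whose vertex set is ancestral. *)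

theory Defs
  imports "HOL-Probability.Probability" "Graph_Theory.Graph_Theory"
begin

text \<open>
  Directed graphs have type \<open>'v pair_pre_digraph\<close>; \<open>pair_digraph\<close> says finite and
  loop-free. In the statement the vertex set is all of the finite type \<open>'v\<close>, so that the library
  types \<open>real ^ 'v\<close> and \<open>real ^ 'v ^ 'v\<close> are the vectors and matrices indexed by the vertices.
\<close>

abbreviation dicycle :: "'v pair_pre_digraph \<Rightarrow> ('v \<times> 'v) list \<Rightarrow> bool" where
  "dicycle G \<equiv> pre_digraph.cycle (with_proj G)"

text \<open>The tails of the arcs of a closed walk are exactly its vertices.\<close>

definition cycle_verts :: "('v \<times> 'v) list \<Rightarrow> 'v set" where
  "cycle_verts p = fst ` set p"

text \<open>
  The library represents a cycle by its list of arcs from some starting point; two such lists are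
  the same cycle of the graph, i.e. agree up to rotation, iff they have the same set of arcs.
\<close>

definition cycle_disjoint :: "'v pair_pre_digraph \<Rightarrow> bool" where
  "cycle_disjoint G \<longleftrightarrow>
     (\<forall>v p q. dicycle G p \<and> dicycle G q \<and> v \<in> cycle_verts p \<and> v \<in> cycle_verts q
        \<longrightarrow> set p = set q)"

definition anc :: "'v pair_pre_digraph \<Rightarrow> 'v set \<Rightarrow> 'v set" where
  "anc G C = {u. \<exists>v\<in>C. reachable (with_proj G) u v}"

definition ancestral :: "'v pair_pre_digraph \<Rightarrow> 'v set \<Rightarrow> bool" where
  "ancestral G C \<longleftrightarrow> anc G C = C"

definition root_cycle :: "'v pair_pre_digraph \<Rightarrow> ('v \<times> 'v) list \<Rightarrow> bool" where
  "root_cycle G p \<longleftrightarrow> dicycle G p \<and> ancestral G (cycle_verts p)"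

definition edge_matrices :: "('v::finite) pair_pre_digraph \<Rightarrow> (real ^ 'v ^ 'v) set" where
  "edge_matrices G =
     {\<Lambda>. invertible (mat 1 - \<Lambda>) \<and> (\<forall>i j. (i, j) \<notin> parcs G \<longrightarrow> \<Lambda> $ i $ j = 0)}"

text \<open>
  A noise vector enters only through its distribution, a Borel probability measure on
  \<open>real ^ 'v\<close> under which the coordinates have the required properties. Finiteness of the third
  absolute moments makes all the expectations below those of integrable functions.
\<close>

definition noise_distr :: "(real ^ 'v::finite) measure \<Rightarrow> bool" where
  "noise_distr \<mu> \<longleftrightarrow>
     prob_space \<mu> \<and> sets \<mu> = sets borel \<and>
     prob_space.indep_vars \<mu> (\<lambda>_. borel) (\<lambda>i \<epsilon>. \<epsilon> $ i) UNIV \<and>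
     (\<forall>i. integrable \<mu> (\<lambda>\<epsilon>. \<bar>\<epsilon> $ i\<bar> ^ 3) \<and>
          prob_space.expectation \<mu> (\<lambda>\<epsilon>. \<epsilon> $ i) = 0 \<and>
          prob_space.variance \<mu> (\<lambda>\<epsilon>. \<epsilon> $ i) > 0)"

definition obs :: "real ^ 'v ^ 'v \<Rightarrow> real ^ 'v \<Rightarrow> real ^ ('v::finite)" where
  "obs \<Lambda> \<epsilon> = transpose (matrix_inv (mat 1 - \<Lambda>)) *v \<epsilon>"

definition s_mom :: "real ^ 'v ^ 'v \<Rightarrow> (real ^ 'v) measure \<Rightarrow> 'v::finite \<Rightarrow> 'v \<Rightarrow> real" where
  "s_mom \<Lambda> \<mu> i j = prob_space.expectation \<mu> (\<lambda>\<epsilon>. obs \<Lambda> \<epsilon> $ i * obs \<Lambda> \<epsilon> $ j)"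

definition t_mom :: "real ^ 'v ^ 'v \<Rightarrow> (real ^ 'v) measure \<Rightarrow> 'v::finite \<Rightarrow> 'v \<Rightarrow> 'v \<Rightarrow> real" where
  "t_mom \<Lambda> \<mu> i j k =
     prob_space.expectation \<mu> (\<lambda>\<epsilon>. obs \<Lambda> \<epsilon> $ i * obs \<Lambda> \<epsilon> $ j * obs \<Lambda> \<epsilon> $ k)"

definition d22 :: "real ^ 'v ^ 'v \<Rightarrow> (real ^ 'v) measure \<Rightarrow> 'v::finite \<Rightarrow> 'v \<Rightarrow> real" where
  "d22 \<Lambda> \<mu> u v =
     (let s = s_mom \<Lambda> \<mu>; t = t_mom \<Lambda> \<mu> in
      det (vector [vector [s u u,   s u v],
                   vector [t u u u, t u u v]] :: real ^ 2 ^ 2))"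

definition d33 :: "real ^ 'v ^ 'v \<Rightarrow> (real ^ 'v) measure \<Rightarrow> 'v::finite \<Rightarrow> 'v \<Rightarrow> real" where
  "d33 \<Lambda> \<mu> u v =
     (let s = s_mom \<Lambda> \<mu>; t = t_mom \<Lambda> \<mu> in
      det (vector [vector [s u u,   s u v,   s v v],
                   vector [t u u u, t u u v, t u v v],
                   vector [t u u v, t u v v, t v v v]] :: real ^ 3 ^ 3))"

definition identically_zero ::
  "('v::finite) pair_pre_digraph \<Rightarrow> (real ^ 'v ^ 'v \<Rightarrow> (real ^ 'v) measure \<Rightarrow> real) \<Rightarrow> bool" where
  "identically_zero G f \<longleftrightarrow> (\<forall>\<Lambda>\<in>edge_matrices G. \<forall>\<mu>. noise_distr \<mu> \<longrightarrow> f \<Lambda> \<mu> = 0)"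

definition admissible :: "('v::finite) pair_pre_digraph \<Rightarrow> 'v set \<Rightarrow> bool" where
  "admissible G C \<longleftrightarrow>
     (\<forall>u\<in>C. \<forall>v\<in>C. u \<noteq> v \<longrightarrow>
        identically_zero G (\<lambda>\<Lambda> \<mu>. d33 \<Lambda> \<mu> u v) \<and>
        \<not> identically_zero G (\<lambda>\<Lambda> \<mu>. d22 \<Lambda> \<mu> u v))"

definition max_admissible :: "('v::finite) pair_pre_digraph \<Rightarrow> 'v set set" where
  "max_admissible G = {C. admissible G C \<and> (\<forall>D. admissible G D \<and> C \<subseteq> D \<longrightarrow> D = C)}"

end

theory Submission
  imports Defs
begin

text \<open>
  Write \<open>b\<^sub>i\<^sub>j\<close> for the entries of \<open>(I - \<Lambda>)\<^sup>-\<^sup>1\<close>, so that \<open>s\<^sub>u\<^sub>v = \<Sum>\<^sub>i E[\<epsilon>\<^sub>i\<^sup>2] b\<^sub>i\<^sub>u b\<^sub>i\<^sub>v\<close> and similarly for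
  the third moments. The root cycle \<open>C\<close> receives no other arcs than its own, hence walking around it
  shows that for \<open>u, v \<in> C\<close> all points \<open>(b\<^sub>i\<^sub>u, b\<^sub>i\<^sub>v)\<close> lie on two fixed lines through the origin; this
  gives a linear relation between the columns of the \<open>3 \<times> 3\<close> matrix.

  Nonvanishing is witnessed by one skewed noise distribution and by matrices \<open>\<Lambda>\<close> supported on a
  breadth-first search tree. For maximality let \<open>w \<notin> C\<close>. If \<open>C\<close> does not reach \<open>w\<close>, then \<open>u \<in> C\<close> and
  \<open>w\<close> have no common ancestor and the \<open>2 \<times> 2\<close> determinant vanishes. Otherwise root the tree at an
  \<open>r \<in> C\<close> closest to \<open>w\<close>: for any other \<open>u \<in> C\<close> the tree paths to \<open>u\<close> and \<open>w\<close> meet only in \<open>r\<close>, so the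
  points \<open>(b\<^sub>i\<^sub>u, b\<^sub>i\<^sub>w)\<close> occupy three lines and the \<open>3 \<times> 3\<close> determinant is nonzero.
\<close>

subsection \<open>Moments of the observed vector\<close>

definition effects :: "real ^ 'v ^ 'v \<Rightarrow> real ^ 'v ^ ('v::finite)" where
  "effects \<Lambda> = matrix_inv (mat 1 - \<Lambda>)"

lemma obs_nth: "obs \<Lambda> \<epsilon> $ u = (\<Sum>i\<in>UNIV. effects \<Lambda> $ i $ u * \<epsilon> $ i)"
  by (simp add: obs_def effects_def matrix_vector_mult_def transpose_def)

text \<open>Writes products of coordinates as monomials over all vertices, the exponents counting
  occurrences, so that independence of the whole family applies at once.\<close>

lemma prod_power_indicator: "(\<Prod>l\<in>UNIV. f l ^ (if l = i then 1 else 0)) = (f i :: real)"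
  for f :: "'v::finite \<Rightarrow> real"
  by (subst prod.cong[where h = "\<lambda>l. if i = l then f l else 1"]) auto

lemma prod_power_indicator2:
  "(\<Prod>l\<in>UNIV. f l ^ ((if l = i then 1 else 0) + (if l = j then 1 else 0))) = (f i * f j :: real)"
  for f :: "'v::finite \<Rightarrow> real"
  by (simp only: power_add prod.distrib prod_power_indicator)

lemma prod_power_indicator3:
  "(\<Prod>l\<in>UNIV. f l ^ ((if l = i then 1 else 0) + (if l = j then 1 else 0) + (if l = k then 1 else 0)))
     = (f i * f j * f k :: real)"
  for f :: "'v::finite \<Rightarrow> real"
  by (simp only: power_add prod.distrib prod_power_indicator)

lemma sum_product3:
  "sum f A * sum g B * sum h C = (\<Sum>i\<in>A. \<Sum>j\<in>B. \<Sum>k\<in>C. f i * g j * h k)"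
  for f g h :: "'b \<Rightarrow> real"
  by (simp add: sum_distrib_left [symmetric] sum_distrib_right [symmetric])

context
  fixes \<mu> :: "(real ^ 'v::finite) measure"
  assumes noise: "noise_distr \<mu>"
begin

interpretation prob_space \<mu>
  using noise by (simp add: noise_distr_def)

lemma noise_indep: "indep_vars (\<lambda>_. borel) (\<lambda>i \<epsilon>. \<epsilon> $ i) UNIV"
  using noise by (simp add: noise_distr_def)

lemma noise_measurable [measurable]: "(\<lambda>\<epsilon>. \<epsilon> $ i) \<in> borel_measurable \<mu>"
  using noise_indep by (simp add: indep_vars_def)

lemma noise_integrable_power:
  assumes "m \<le> 3"
  shows "integrable \<mu> (\<lambda>\<epsilon>. (\<epsilon> $ i) ^ m)"
proof (rule Bochner_Integration.integrable_bound)
  show "integrable \<mu> (\<lambda>\<epsilon>. 1 + \<bar>\<epsilon> $ i\<bar> ^ 3)"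
    using noise by (simp add: noise_distr_def)
  have "\<bar>x\<bar> ^ m \<le> 1 + \<bar>x\<bar> ^ 3" for x :: real
  proof (cases "\<bar>x\<bar> \<le> 1")
    case True
    then have "\<bar>x\<bar> ^ m \<le> 1" by (simp add: power_le_one)
    then show ?thesis by (smt (verit) zero_le_power abs_ge_zero)
  next
    case False
    then have "\<bar>x\<bar> ^ m \<le> \<bar>x\<bar> ^ 3" using assms by (intro power_increasing) auto
    then show ?thesis by simp
  qed
  then show "AE \<epsilon> in \<mu>. norm ((\<epsilon> $ i) ^ m) \<le> norm (1 + \<bar>\<epsilon> $ i\<bar> ^ 3)"
    by (auto simp: power_abs)
qed measurable

text \<open>Powers of independent coordinates are again independent, so the expectation of the
  product factors.\<close>

lemma
  fixes m :: "'v \<Rightarrow> nat"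
  assumes "\<And>l. m l \<le> 3"
  shows noise_integrable_monomial: "integrable \<mu> (\<lambda>\<epsilon>. \<Prod>l\<in>UNIV. (\<epsilon> $ l) ^ m l)"
    and noise_expectation_monomial:
      "expectation (\<lambda>\<epsilon>. \<Prod>l\<in>UNIV. (\<epsilon> $ l) ^ m l) = (\<Prod>l\<in>UNIV. expectation (\<lambda>\<epsilon>. (\<epsilon> $ l) ^ m l))"
proof -
  have "indep_vars (\<lambda>_. borel) (\<lambda>l \<epsilon>. (\<epsilon> $ l) ^ m l) UNIV"
    by (rule indep_vars_compose2[OF noise_indep, where Y = "\<lambda>l x. x ^ m l"]) simp
  then show "integrable \<mu> (\<lambda>\<epsilon>. \<Prod>l\<in>UNIV. (\<epsilon> $ l) ^ m l)"
    and "expectation (\<lambda>\<epsilon>. \<Prod>l\<in>UNIV. (\<epsilon> $ l) ^ m l) = (\<Prod>l\<in>UNIV. expectation (\<lambda>\<epsilon>. (\<epsilon> $ l) ^ m l))"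
    by (auto intro!: indep_vars_integrable indep_vars_lebesgue_integral noise_integrable_power assms)
qed

lemma noise_expectation_zero:
  assumes "\<And>l. m l \<le> 3" and "m l = 1"
  shows "expectation (\<lambda>\<epsilon>. \<Prod>l\<in>UNIV. (\<epsilon> $ l) ^ m l) = 0"
proof -
  have "expectation (\<lambda>\<epsilon>. (\<epsilon> $ l) ^ m l) = 0"
    using noise assms(2) by (simp add: noise_distr_def)
  then show ?thesis
    unfolding noise_expectation_monomial[OF assms(1)] by (auto intro!: prod_zero)
qed

lemma noise_moment2:
  shows "integrable \<mu> (\<lambda>\<epsilon>. \<epsilon> $ i * \<epsilon> $ j)"
    and "expectation (\<lambda>\<epsilon>. \<epsilon> $ i * \<epsilon> $ j) = (if i = j then expectation (\<lambda>\<epsilon>. (\<epsilon> $ i)\<^sup>2) else 0)"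
proof -
  let ?m = "\<lambda>l. (if l = i then 1 else 0) + (if l = j then 1 else 0) :: nat"
  show "integrable \<mu> (\<lambda>\<epsilon>. \<epsilon> $ i * \<epsilon> $ j)"
    using noise_integrable_monomial[of ?m] by (simp only: prod_power_indicator2) simp
  show "expectation (\<lambda>\<epsilon>. \<epsilon> $ i * \<epsilon> $ j) = (if i = j then expectation (\<lambda>\<epsilon>. (\<epsilon> $ i)\<^sup>2) else 0)"
    using noise_expectation_zero[of ?m i]
    by (cases "i = j") (simp_all only: prod_power_indicator2, simp_all add: power2_eq_square)
qed

text \<open>Only the diagonal survives. The conditionals are nested so that the sums over
  \<open>k\<close> and then \<open>j\<close> collapse one after the other.\<close>

lemma noise_moment3:
  shows "integrable \<mu> (\<lambda>\<epsilon>. \<epsilon> $ i * \<epsilon> $ j * \<epsilon> $ k)"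
    and "expectation (\<lambda>\<epsilon>. \<epsilon> $ i * \<epsilon> $ j * \<epsilon> $ k)
      = (if j = k then if i = j then expectation (\<lambda>\<epsilon>. (\<epsilon> $ i) ^ 3) else 0 else 0)"
proof -
  let ?m = "\<lambda>l. (if l = i then 1 else 0) + (if l = j then 1 else 0) + (if l = k then 1 else 0) :: nat"
  show "integrable \<mu> (\<lambda>\<epsilon>. \<epsilon> $ i * \<epsilon> $ j * \<epsilon> $ k)"
    using noise_integrable_monomial[of ?m] by (simp only: prod_power_indicator3) simp
  show "expectation (\<lambda>\<epsilon>. \<epsilon> $ i * \<epsilon> $ j * \<epsilon> $ k)
      = (if j = k then if i = j then expectation (\<lambda>\<epsilon>. (\<epsilon> $ i) ^ 3) else 0 else 0)"
  proof (cases "i = j \<and> i = k")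
    case True
    then show ?thesis by (auto simp: power3_eq_cube)
  next
    case False
    \<comment> \<open>Three indices that are not all equal include one occurring exactly once; its
      centered coordinate kills the expectation.\<close>
    then have "\<exists>l. ?m l = 1" by (cases "i = j"; cases "i = k"; cases "j = k"; force)
    then obtain l where "?m l = 1" ..
    from noise_expectation_zero[of ?m, OF _ this] False show ?thesis
      by (simp only: prod_power_indicator3) auto
  qed
qed

lemma s_mom_eq:
  "s_mom \<Lambda> \<mu> u v =
     (\<Sum>i\<in>UNIV. expectation (\<lambda>\<epsilon>. (\<epsilon> $ i)\<^sup>2) * (effects \<Lambda> $ i $ u * effects \<Lambda> $ i $ v))"
proof -
  let ?B = "effects \<Lambda>"
  have "s_mom \<Lambda> \<mu> u v
      = expectation (\<lambda>\<epsilon>. \<Sum>i\<in>UNIV. \<Sum>j\<in>UNIV. ?B $ i $ u * ?B $ j $ v * (\<epsilon> $ i * \<epsilon> $ j))"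
    unfolding s_mom_def obs_nth sum_product by (simp add: mult_ac)
  also have "\<dots> = (\<Sum>i\<in>UNIV. \<Sum>j\<in>UNIV. ?B $ i $ u * ?B $ j $ v * expectation (\<lambda>\<epsilon>. \<epsilon> $ i * \<epsilon> $ j))"
    by (simp add: noise_moment2(1) Bochner_Integration.integral_sum)
  also have "\<dots> = (\<Sum>i\<in>UNIV. expectation (\<lambda>\<epsilon>. (\<epsilon> $ i)\<^sup>2) * (?B $ i $ u * ?B $ i $ v))"
    by (simp add: noise_moment2(2) if_distrib[where f = "(*) _"] mult_ac cong: if_cong)
  finally show ?thesis .
qed

lemma t_mom_eq:
  "t_mom \<Lambda> \<mu> u v w =
     (\<Sum>i\<in>UNIV. expectation (\<lambda>\<epsilon>. (\<epsilon> $ i) ^ 3)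
        * (effects \<Lambda> $ i $ u * effects \<Lambda> $ i $ v * effects \<Lambda> $ i $ w))"
proof -
  let ?B = "effects \<Lambda>"
  have "t_mom \<Lambda> \<mu> u v w
      = expectation (\<lambda>\<epsilon>. \<Sum>i\<in>UNIV. \<Sum>j\<in>UNIV. \<Sum>k\<in>UNIV.
          ?B $ i $ u * ?B $ j $ v * ?B $ k $ w * (\<epsilon> $ i * \<epsilon> $ j * \<epsilon> $ k))"
    unfolding t_mom_def obs_nth sum_product3 by (simp add: mult_ac)
  also have "\<dots> = (\<Sum>i\<in>UNIV. \<Sum>j\<in>UNIV. \<Sum>k\<in>UNIV.
          ?B $ i $ u * ?B $ j $ v * ?B $ k $ w * expectation (\<lambda>\<epsilon>. \<epsilon> $ i * \<epsilon> $ j * \<epsilon> $ k))"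
    by (simp add: noise_moment3(1) Bochner_Integration.integral_sum)
  also have "\<dots> = (\<Sum>i\<in>UNIV. expectation (\<lambda>\<epsilon>. (\<epsilon> $ i) ^ 3)
        * (?B $ i $ u * ?B $ i $ v * ?B $ i $ w))"
    unfolding noise_moment3(2)
    by (simp add: if_distrib[where f = "(*) _"] mult_ac cong: if_cong)
  finally show ?thesis .
qed

end

section \<open>A skewed noise distribution\<close>

definition skewed_pmf :: "real pmf" where
  "skewed_pmf = map_pmf (\<lambda>b. if b then 2 else - 1) (bernoulli_pmf (1 / 3))"

definition skewed_noise :: "(real ^ 'v::finite) measure" where
  "skewed_noise = distr (measure_pmf (Pi_pmf UNIV 0 (\<lambda>_. skewed_pmf))) borel vec_lambda"

text \<open>For the first three powers this gives mean 0 and second and third moments both equal to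
  2.\<close>

lemma integral_skewed_pmf: "measure_pmf.expectation skewed_pmf f = f 2 / 3 + 2 * f (- 1) / 3"
  for f :: "real \<Rightarrow> real"
  by (simp add: skewed_pmf_def)

lemma integrable_skewed_pmf: "integrable skewed_pmf f" for f :: "real \<Rightarrow> real"
  by (rule integrable_measure_pmf_finite) (simp add: skewed_pmf_def)

lemma
  fixes f :: "real \<Rightarrow> real" and i :: "'v::finite"
  assumes [measurable]: "f \<in> borel_measurable borel"
  shows integrable_skewed_noise: "integrable skewed_noise (\<lambda>\<epsilon>. f (\<epsilon> $ i))"
    and integral_skewed_noise: "(\<integral>\<epsilon>. f (\<epsilon> $ i) \<partial>skewed_noise) = f 2 / 3 + 2 * f (- 1) / 3"
proof -
  let ?P = "Pi_pmf (UNIV :: 'v set) 0 (\<lambda>_. skewed_pmf)"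
  have comp: "map_pmf (\<lambda>g. g i) ?P = skewed_pmf"
    by (simp add: Pi_pmf_component)
  have "integrable (measure_pmf (map_pmf (\<lambda>g. g i) ?P)) f"
    unfolding comp by (rule integrable_skewed_pmf)
  then show "integrable skewed_noise (\<lambda>\<epsilon>. f (\<epsilon> $ i))"
    by (simp add: skewed_noise_def integrable_distr_eq)
  have "measure_pmf.expectation (map_pmf (\<lambda>g. g i) ?P) f = f 2 / 3 + 2 * f (- 1) / 3"
    unfolding comp by (rule integral_skewed_pmf)
  then show "(\<integral>\<epsilon>. f (\<epsilon> $ i) \<partial>skewed_noise) = f 2 / 3 + 2 * f (- 1) / 3"
    by (simp add: skewed_noise_def integral_distr)
qed

text \<open>Independence says that the joint law is the product of the marginals, and these laws are
  the same under the image measure as for the composed variables. This carries independence over to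
  \<open>skewed_noise\<close>.\<close>

lemma indep_vars_distr:
  assumes P: "prob_space P" and g [measurable]: "g \<in> measurable P M"
    and X [measurable]: "\<And>i. i \<in> I \<Longrightarrow> X i \<in> measurable M (N i)"
    and "I \<noteq> {}" and ind: "prob_space.indep_vars P N (\<lambda>i x. X i (g x)) I"
  shows "prob_space.indep_vars (distr P M g) N X I"
proof -
  interpret P: prob_space P by fact
  interpret D: prob_space "distr P M g" by (rule P.prob_space_distr) fact
  have "distr (distr P M g) (PiM I N) (\<lambda>x. \<lambda>i\<in>I. X i x)
      = distr P (PiM I N) (\<lambda>x. \<lambda>i\<in>I. X i (g x))"
    by (subst distr_distr) (auto simp: comp_def intro!: measurable_restrict)
  also have "\<dots> = (\<Pi>\<^sub>M i\<in>I. distr P (N i) (\<lambda>x. X i (g x)))"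
    using ind \<open>I \<noteq> {}\<close> by (subst (asm) P.indep_vars_iff_distr_eq_PiM') auto
  also have "\<dots> = (\<Pi>\<^sub>M i\<in>I. distr (distr P M g) (N i) (X i))"
    by (intro PiM_cong refl) (simp add: distr_distr comp_def)
  finally show ?thesis
    using \<open>I \<noteq> {}\<close> by (subst D.indep_vars_iff_distr_eq_PiM') auto
qed

lemma noise_distr_skewed_noise: "noise_distr (skewed_noise :: (real ^ 'v::finite) measure)"
proof -
  let ?P = "measure_pmf (Pi_pmf (UNIV :: 'v set) 0 (\<lambda>_. skewed_pmf))"
  have "prob_space.indep_vars ?P (\<lambda>_. count_space UNIV) (\<lambda>i g. g i) UNIV"
    by (rule indep_vars_Pi_pmf) simp
  then have "prob_space.indep_vars ?P (\<lambda>_. borel) (\<lambda>i g. g i) UNIV"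
    by (rule prob_space.indep_vars_compose2[where Y = "\<lambda>_ x. x", OF measure_pmf.prob_space_axioms]) simp
  then have "prob_space.indep_vars (skewed_noise :: (real ^ 'v) measure) (\<lambda>_. borel) (\<lambda>i \<epsilon>. \<epsilon> $ i) UNIV"
    unfolding skewed_noise_def
    by (intro indep_vars_distr) (auto simp: measure_pmf.prob_space_axioms)
  moreover have "prob_space (skewed_noise :: (real ^ 'v) measure)"
    unfolding skewed_noise_def by (intro measure_pmf.prob_space_distr) simp
  moreover have "sets (skewed_noise :: (real ^ 'v) measure) = sets borel"
    by (simp add: skewed_noise_def)
  ultimately show ?thesis
    using integrable_skewed_noise[of "\<lambda>x. \<bar>x\<bar> ^ 3" "_ :: 'v"] integral_skewed_noise[of "\<lambda>x. x" "_ :: 'v"]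
      integral_skewed_noise[of "\<lambda>x. x\<^sup>2" "_ :: 'v"]
    by (simp add: noise_distr_def)
qed

subsection \<open>The determinants and the inverse matrix\<close>

lemma d22_eq: "d22 \<Lambda> \<mu> u v
    = s_mom \<Lambda> \<mu> u u * t_mom \<Lambda> \<mu> u u v - s_mom \<Lambda> \<mu> u v * t_mom \<Lambda> \<mu> u u u"
  by (simp add: d22_def Let_def det_2)

lemma d33_eq: "d33 \<Lambda> \<mu> u v =
    s_mom \<Lambda> \<mu> u u * (t_mom \<Lambda> \<mu> u u v * t_mom \<Lambda> \<mu> v v v - (t_mom \<Lambda> \<mu> u v v)\<^sup>2)
  - s_mom \<Lambda> \<mu> u v * (t_mom \<Lambda> \<mu> u u u * t_mom \<Lambda> \<mu> v v v - t_mom \<Lambda> \<mu> u v v * t_mom \<Lambda> \<mu> u u v)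
  + s_mom \<Lambda> \<mu> v v * (t_mom \<Lambda> \<mu> u u u * t_mom \<Lambda> \<mu> u v v - (t_mom \<Lambda> \<mu> u u v)\<^sup>2)"
  by (simp add: d33_def Let_def det_3 algebra_simps power2_eq_square)

text \<open>The two lines form the conic \<open>(x - a * y) * (y - b * x) = 0\<close>. Summing its
  equation over all points, with weights that produce one row of moments at a time, gives the same
  linear relation between the entries of each row.\<close>

lemma d33_eq_zero:
  assumes noise: "noise_distr \<mu>"
    and lines: "\<And>i. effects \<Lambda> $ i $ u = a * effects \<Lambda> $ i $ v
                  \<or> effects \<Lambda> $ i $ v = b * effects \<Lambda> $ i $ u"
  shows "d33 \<Lambda> \<mu> u v = 0"
proof -
  define x y where "x i = effects \<Lambda> $ i $ u" and "y i = effects \<Lambda> $ i $ v" for i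
  have xy: "(1 + a * b) * (x i * y i) = b * (x i * x i) + a * (y i * y i)" for i
    using lines[of i] unfolding x_def y_def by (auto simp: algebra_simps)
  have rel: "(1 + a * b) * (\<Sum>i\<in>UNIV. c i * (x i * y i))
      = b * (\<Sum>i\<in>UNIV. c i * (x i * x i)) + a * (\<Sum>i\<in>UNIV. c i * (y i * y i))" for c
    unfolding sum_distrib_left sum.distrib [symmetric]
    using xy by (intro sum.cong refl) (metis (no_types, lifting) distrib_left mult.left_commute)
  define s where "s = s_mom \<Lambda> \<mu>"
  define t where "t = t_mom \<Lambda> \<mu>"
  define D where "D = d33 \<Lambda> \<mu> u v"
  let ?k = "\<lambda>i. prob_space.expectation \<mu> (\<lambda>\<epsilon>. (\<epsilon> $ i) ^ 3)"
  have 1: "(1 + a * b) * s u v = b * s u u + a * s v v"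
    unfolding s_def s_mom_eq[OF noise] using rel unfolding x_def y_def .
  have 2: "(1 + a * b) * t u u v = b * t u u u + a * t u v v"
    using rel[of "\<lambda>i. ?k i * x i"] unfolding t_def t_mom_eq[OF noise] x_def y_def
    by (simp add: mult_ac)
  have 3: "(1 + a * b) * t u v v = b * t u u v + a * t v v v"
    using rel[of "\<lambda>i. ?k i * y i"] unfolding t_def t_mom_eq[OF noise] x_def y_def
    by (simp add: mult_ac)
  have D: "D = s u u * (t u u v * t v v v - (t u v v)\<^sup>2)
      - s u v * (t u u u * t v v v - t u v v * t u u v)
      + s v v * (t u u u * t u v v - (t u u v)\<^sup>2)"
    unfolding D_def d33_eq s_def t_def ..
  \<comment> \<open>The columns satisfy a relation with coefficients \<open>b\<close>,
    \<open>- (1 + a * b)\<close> and \<open>a\<close>, so each coefficient times \<open>D\<close>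
    vanishes. They are not all zero, since \<open>a = 0\<close> makes \<open>1 + a * b\<close> equal
    to 1.\<close>
  have "a * D = 0" using 1 2 3 unfolding D by algebra
  moreover have "b * D = 0" using 1 2 3 unfolding D by algebra
  moreover have "(1 + a * b) * D = 0" using 1 2 3 unfolding D by algebra
  ultimately show ?thesis
    unfolding D_def by auto
qed

section \<open>Entries of the inverse matrix\<close>

lemma effects_left:
  assumes "\<Lambda> \<in> edge_matrices G"
  shows "effects \<Lambda> ** (mat 1 - \<Lambda>) = mat 1"
proof -
  have "\<exists>B. (mat 1 - \<Lambda>) ** B = mat 1 \<and> B ** (mat 1 - \<Lambda>) = mat 1"
    using assms by (simp add: edge_matrices_def invertible_def)
  from someI_ex[OF this] show ?thesis
    by (simp add: effects_def matrix_inv_def)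
qed

text \<open>This is \<open>B = I + B \<Lambda>\<close> read entrywise: noise reaches
  \<open>j\<close> through the arcs into \<open>j\<close>, apart from the noise of \<open>j\<close>
  itself.\<close>

lemma effects_rec:
  assumes "\<Lambda> \<in> edge_matrices G"
  shows "effects \<Lambda> $ i $ j = (if i = j then 1 else 0) + (\<Sum>k\<in>UNIV. effects \<Lambda> $ i $ k * \<Lambda> $ k $ j)"
proof -
  have "(effects \<Lambda> ** (mat 1 - \<Lambda>)) $ i $ j = mat 1 $ i $ j"
    by (simp add: effects_left[OF assms])
  then have "(\<Sum>k\<in>UNIV. effects \<Lambda> $ i $ k * ((if k = j then 1 else 0) - \<Lambda> $ k $ j))
      = (if i = j then 1 else 0)"
    by (simp add: matrix_matrix_mult_def mat_def)
  then show ?thesis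
    by (simp add: right_diff_distrib sum_subtractf if_distrib[where f = "(*) _"] cong: if_cong)
qed

text \<open>\<open>mat 1 - \<Lambda>\<close> maps the space of vectors supported on \<open>A\<close> injectively, hence onto, itself.\<close>

lemma effects_eq_zero:
  fixes G :: "('v::finite) pair_pre_digraph"
  assumes \<Lambda>: "\<Lambda> \<in> edge_matrices G"
    and A: "\<And>i j. (i, j) \<in> parcs G \<Longrightarrow> j \<in> A \<Longrightarrow> i \<in> A"
    and "j \<in> A" "i \<notin> A"
  shows "effects \<Lambda> $ i $ j = 0"
proof -
  define M where "M = mat 1 - \<Lambda>"
  define V where "V = {x :: real ^ 'v. \<forall>i. i \<notin> A \<longrightarrow> x $ i = 0}"
  have V: "subspace V"
    by (auto simp: V_def subspace_def)
  have M0: "M $ i $ k = 0" if "i \<notin> A" "k \<in> A" for i k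
  proof -
    from that A have "(i, k) \<notin> parcs G" by blast
    with \<Lambda> have "\<Lambda> $ i $ k = 0" by (simp add: edge_matrices_def)
    with that show ?thesis by (auto simp: M_def mat_def)
  qed
  have sub: "(*v) M ` V \<subseteq> V"
  proof
    fix z assume "z \<in> (*v) M ` V"
    then obtain x where x: "x \<in> V" and z: "z = M *v x" by blast
    have "M $ i $ k * x $ k = 0" if "i \<notin> A" for i k
      using M0[OF that, of k] x by (cases "k \<in> A") (auto simp: V_def)
    then have "(\<Sum>k\<in>UNIV. M $ i $ k * x $ k) = 0" if "i \<notin> A" for i
      using that by (intro sum.neutral) blast
    then show "z \<in> V"
      by (simp add: z V_def matrix_vector_mult_def)
  qed
  have BM: "effects \<Lambda> *v (M *v x) = x" for x
    by (simp add: M_def matrix_vector_mul_assoc effects_left[OF \<Lambda>])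
  then have "inj ((*v) M)"
    by (metis injI)
  then have "dim ((*v) M ` V) = dim V"
    by (intro dim_image_eq) (auto intro: inj_on_subset)
  with V sub have "(*v) M ` V = V"
    by (intro subspace_dim_equal) (auto intro: linear_subspace_image)
  moreover have "axis j 1 \<in> V"
    using \<open>j \<in> A\<close> by (auto simp: V_def axis_def)
  ultimately obtain x where x: "x \<in> V" "axis j 1 = M *v x" by blast
  then have "x = effects \<Lambda> *v axis j 1"
    by (simp add: BM)
  then have "x $ i = effects \<Lambda> $ i $ j"
    by (simp add: matrix_vector_mult_basis column_def)
  with x \<open>i \<notin> A\<close> show ?thesis
    by (simp add: V_def)
qed

text \<open>No noise term enters both variables, so the second column of the determinant
  vanishes.\<close>

lemma d22_eq_zero:
  assumes "noise_distr \<mu>" and "\<And>i. effects \<Lambda> $ i $ u = 0 \<or> effects \<Lambda> $ i $ v = 0"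
  shows "d22 \<Lambda> \<mu> u v = 0"
proof -
  have "effects \<Lambda> $ i $ u * effects \<Lambda> $ i $ v = 0"
    "effects \<Lambda> $ i $ u * effects \<Lambda> $ i $ u * effects \<Lambda> $ i $ v = 0" for i
    using assms(2)[of i] by auto
  then have "s_mom \<Lambda> \<mu> u v = 0" "t_mom \<Lambda> \<mu> u u v = 0"
    unfolding s_mom_eq[OF assms(1)] t_mom_eq[OF assms(1)] by (simp_all only: mult_zero_right sum.neutral_const)
  then show ?thesis by (simp add: d22_eq)
qed

subsection \<open>Breadth-first search trees\<close>

definition dist_from :: "'a rel \<Rightarrow> 'a \<Rightarrow> 'a \<Rightarrow> nat" where
  "dist_from E r j = (LEAST n. (r, j) \<in> E ^^ n)"

lemma dist_from_le: "(r, j) \<in> E ^^ n \<Longrightarrow> dist_from E r j \<le> n"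
  by (simp add: dist_from_def Least_le)

lemma relpow_dist_from: "(r, j) \<in> E\<^sup>* \<Longrightarrow> (r, j) \<in> E ^^ dist_from E r j"
  unfolding dist_from_def by (rule LeastI_ex) (simp add: rtrancl_imp_relpow)

text \<open>The parent is the last vertex before \<open>j\<close> on a shortest walk; a shorter way
  to it would shorten the walk to \<open>j\<close>.\<close>

lemma bfs_parent:
  assumes "(r, j) \<in> E\<^sup>*" "j \<noteq> r"
  obtains i where "(i, j) \<in> E" "(r, i) \<in> E\<^sup>*" "dist_from E r j = Suc (dist_from E r i)"
proof -
  have n: "(r, j) \<in> E ^^ dist_from E r j"
    using assms(1) by (rule relpow_dist_from)
  with assms(2) obtain m where m: "dist_from E r j = Suc m"
    by (cases "dist_from E r j") auto
  with n obtain i where i: "(r, i) \<in> E ^^ m" "(i, j) \<in> E" by auto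
  then have ri: "(r, i) \<in> E\<^sup>*"
    by (auto intro: relpow_imp_rtrancl)
  have "(r, j) \<in> E ^^ Suc (dist_from E r i)"
    using relpow_dist_from[OF ri] i(2) by auto
  from dist_from_le[OF this] dist_from_le[OF i(1)] m show ?thesis
    by (intro that[OF i(2) ri]) simp
qed

text \<open>
  Arcs of the tree leaving the root get weight 2, all others weight 1: with all weights equal to 1
  and identically distributed noise, the \<open>2 \<times> 2\<close> determinant would vanish.
\<close>

lemma bfs_tree_effects:
  fixes G :: "('v::finite) pair_pre_digraph" and r :: 'v
  defines "E \<equiv> parcs G"
  obtains \<Lambda> where "\<Lambda> \<in> edge_matrices G"
    and "\<And>i. effects \<Lambda> $ i $ r = (if i = r then 1 else 0)"
    and "\<And>j. (r, j) \<in> E\<^sup>* \<Longrightarrow> j \<noteq> r \<Longrightarrow> effects \<Lambda> $ r $ j = 2"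
    and "\<And>j. (r, j) \<in> E\<^sup>* \<Longrightarrow> j \<noteq> r \<Longrightarrow> effects \<Lambda> $ j $ j = 1"
    and "\<And>i j. (r, j) \<in> E\<^sup>* \<Longrightarrow> j \<noteq> r \<Longrightarrow> i \<noteq> r \<Longrightarrow> effects \<Lambda> $ i $ j \<in> {0, 1}"
    and "\<And>i j. (r, j) \<in> E\<^sup>* \<Longrightarrow> j \<noteq> r \<Longrightarrow> i \<noteq> r \<Longrightarrow> effects \<Lambda> $ i $ j \<noteq> 0 \<Longrightarrow>
           \<exists>m n. (r, i) \<in> E ^^ m \<and> (i, j) \<in> E ^^ n \<and> m + n = dist_from E r j"
proof -
  define S where "S = {j. (r, j) \<in> E\<^sup>* \<and> j \<noteq> r}"
  have "\<forall>j\<in>S. \<exists>i. (i, j) \<in> E \<and> (r, i) \<in> E\<^sup>* \<and> dist_from E r j = Suc (dist_from E r i)"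
    unfolding S_def by (auto elim: bfs_parent)
  then obtain \<pi> where \<pi>: "\<And>j. j \<in> S \<Longrightarrow> (\<pi> j, j) \<in> E"
    "\<And>j. j \<in> S \<Longrightarrow> (r, \<pi> j) \<in> E\<^sup>*"
    "\<And>j. j \<in> S \<Longrightarrow> dist_from E r j = Suc (dist_from E r (\<pi> j))"
    by metis
  define w :: "'v \<Rightarrow> real" where "w j = (if \<pi> j = r then 2 else 1)" for j
  define \<Lambda> :: "real ^ 'v ^ 'v" where "\<Lambda> = (\<chi> i j. if j \<in> S then if i = \<pi> j then w j else 0 else 0)"
  have sum_\<Lambda>: "(\<Sum>k\<in>UNIV. f k * \<Lambda> $ k $ j) = (if j \<in> S then f (\<pi> j) * w j else 0)" for f j
    by (simp add: \<Lambda>_def if_distrib[where f = "(*) _"] cong: if_cong)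
  \<comment> \<open>A kernel vector satisfies \<open>x $ j = x $ \<pi> j * w j\<close> on
    \<open>S\<close> and vanishes outside \<open>S\<close>, in particular at \<open>r\<close>.
    Induction on the depth then kills it.\<close>
  have "x = 0" if x: "transpose (mat 1 - \<Lambda>) *v x = 0" for x
  proof -
    have "x $ j = (if j \<in> S then x $ \<pi> j * w j else 0)" for j
    proof -
      have "(\<Sum>k\<in>UNIV. x $ k * ((if k = j then 1 else 0) - \<Lambda> $ k $ j)) = 0"
        using x by (simp add: vec_eq_iff matrix_vector_mult_def transpose_def mat_def mult.commute)
      then have "x $ j - (\<Sum>k\<in>UNIV. x $ k * \<Lambda> $ k $ j) = 0"
        by (simp add: right_diff_distrib sum_subtractf if_distrib[where f = "(*) _"] cong: if_cong)
      then show ?thesis unfolding sum_\<Lambda> by simp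
    qed
    note rec = this
    have "x $ j = 0" for j
    proof (induction "dist_from E r j" arbitrary: j rule: less_induct)
      case less
      show ?case
        using less[of "\<pi> j"] \<pi>(3)[of j] rec[of j] by (cases "j \<in> S") auto
    qed
    then show "x = 0" by (simp add: vec_eq_iff)
  qed
  then have "invertible (transpose (mat 1 - \<Lambda>))"
    unfolding invertible_left_inverse matrix_left_invertible_ker by blast
  then have "invertible (mat 1 - \<Lambda>)"
    by (simp add: invertible_det_nz)
  moreover have "\<Lambda> $ i $ j = 0" if "(i, j) \<notin> parcs G" for i j
    using that \<pi>(1)[of j] by (auto simp: \<Lambda>_def E_def)
  ultimately have \<Lambda>: "\<Lambda> \<in> edge_matrices G"
    by (simp add: edge_matrices_def)
  define B where "B = effects \<Lambda>"
  have rec: "B $ i $ j = (if i = j then 1 else 0) + (if j \<in> S then B $ i $ \<pi> j * w j else 0)" for i j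
    using effects_rec[OF \<Lambda>] unfolding B_def sum_\<Lambda> .
  have root: "B $ i $ r = (if i = r then 1 else 0)" for i
    unfolding rec[of i r] by (simp add: S_def)
  \<comment> \<open>Off the row of the root, an entry is 1 if \<open>i\<close> lies on the tree path
    to \<open>j\<close> and 0 otherwise. The length equation records that \<open>i\<close> then lies
    on a shortest walk from \<open>r\<close> to \<open>j\<close>.\<close>
  have "B $ r $ j = 2 \<and> B $ j $ j = 1 \<and> (\<forall>i. i \<noteq> r \<longrightarrow> B $ i $ j \<in> {0, 1} \<and>
      (B $ i $ j \<noteq> 0 \<longrightarrow> (\<exists>m n. (r, i) \<in> E ^^ m \<and> (i, j) \<in> E ^^ n \<and> m + n = dist_from E r j)))"
    if "j \<in> S" for j
    using that
  proof (induction "dist_from E r j" arbitrary: j rule: less_induct)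
    case (less j)
    then have j: "j \<noteq> r" and rj: "(r, j) \<in> E\<^sup>*" by (auto simp: S_def)
    have self: "\<exists>m n. (r, j) \<in> E ^^ m \<and> (j, j) \<in> E ^^ n \<and> m + n = dist_from E r j"
      using relpow_dist_from[OF rj] by (intro exI[of _ "dist_from E r j"] exI[of _ 0]) simp
    show ?case
    proof (cases "\<pi> j = r")
      case True
      then have "B $ i $ j = (if i = j then 1 else 0) + (if i = r then 2 else 0)" for i
        using rec[of i j] root[of i] less.prems by (simp add: w_def)
      with j self show ?thesis by auto
    next
      case False
      then have step: "B $ i $ j = (if i = j then 1 else 0) + B $ i $ \<pi> j" for i
        using rec[of i j] less.prems by (simp add: w_def)
      have "\<pi> j \<in> S"
        using False \<pi>(2)[OF less.prems] by (simp add: S_def)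
      note IH = less.hyps[OF _ this, unfolded \<pi>(3)[OF less.prems], OF lessI]
      \<comment> \<open>\<open>j\<close> is one step farther from \<open>r\<close> than its parent,
        so it is on no shortest walk to the parent, and the diagonal 1 is added to 0.\<close>
      have "B $ j $ \<pi> j = 0"
      proof (rule ccontr)
        assume "B $ j $ \<pi> j \<noteq> 0"
        with IH j obtain m n where "(r, j) \<in> E ^^ m" "m + n = dist_from E r (\<pi> j)" by blast
        with dist_from_le[of r j m E] \<pi>(3)[OF less.prems] show False by simp
      qed
      moreover have "\<exists>m n. (r, i) \<in> E ^^ m \<and> (i, j) \<in> E ^^ n \<and> m + n = dist_from E r j"
        if i: "i \<noteq> r" "B $ i $ \<pi> j \<noteq> 0" for i
      proof -
        from IH i obtain m n where mn: "(r, i) \<in> E ^^ m" "(i, \<pi> j) \<in> E ^^ n"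
            "m + n = dist_from E r (\<pi> j)"
          by blast
        then have "(i, j) \<in> E ^^ Suc n"
          using \<pi>(1)[OF less.prems] by auto
        with mn show ?thesis
          using \<pi>(3)[OF less.prems] by (metis add_Suc_right)
      qed
      ultimately show ?thesis
        using IH j self unfolding step by auto
    qed
  qed
  then show ?thesis
    using that[OF \<Lambda>] root unfolding B_def S_def by blast
qed

section \<open>Nonvanishing determinants under the skewed noise\<close>

lemma
  fixes \<Lambda> :: "real ^ 'v ^ ('v::finite)"
  shows s_mom_skewed_noise:
      "s_mom \<Lambda> skewed_noise u v = 2 * (\<Sum>i\<in>UNIV. effects \<Lambda> $ i $ u * effects \<Lambda> $ i $ v)"
    and t_mom_skewed_noise:
      "t_mom \<Lambda> skewed_noise u v w
         = 2 * (\<Sum>i\<in>UNIV. effects \<Lambda> $ i $ u * effects \<Lambda> $ i $ v * effects \<Lambda> $ i $ w)"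
  using integral_skewed_noise[of "\<lambda>x. x ^ 2" "_ :: 'v"] integral_skewed_noise[of "\<lambda>x. x ^ 3" "_ :: 'v"]
  by (simp_all add: s_mom_eq t_mom_eq noise_distr_skewed_noise sum_distrib_left)

lemma sum_UNIV_remove: "(\<Sum>i\<in>UNIV. f i) = f r + (\<Sum>i\<in>- {r}. f i)"
  for f :: "'v::finite \<Rightarrow> real"
  by (simp add: sum.remove[of UNIV r] Compl_eq_Diff_UNIV)

text \<open>The noise at \<open>r\<close> gives the point \<open>(2, 1)\<close>, all other noise
  terms give \<open>(1, 0)\<close>, which occurs \<open>n\<close> times, or \<open>(0, 0)\<close>.
  Up to the noise moments the rows are \<open>(4 + n, 2)\<close> and
  \<open>(8 + n, 4)\<close>.\<close>

lemma d22_not_identically_zero: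
  fixes G :: "('v::finite) pair_pre_digraph"
  assumes r: "(r, u) \<in> (parcs G)\<^sup>*" "u \<noteq> r"
  shows "\<not> identically_zero G (\<lambda>\<Lambda> \<mu>. d22 \<Lambda> \<mu> u r)"
proof -
  obtain \<Lambda> where \<Lambda>: "\<Lambda> \<in> edge_matrices G"
    and root: "\<And>i. effects \<Lambda> $ i $ r = (if i = r then 1 else 0)"
    and ru: "effects \<Lambda> $ r $ u = 2" and uu: "effects \<Lambda> $ u $ u = 1"
    and iu: "\<And>i. i \<noteq> r \<Longrightarrow> effects \<Lambda> $ i $ u \<in> {0, 1}"
    using r by (rule_tac r = r and G = G in bfs_tree_effects) blast
  define n where "n = (\<Sum>i\<in>- {r}. effects \<Lambda> $ i $ u)"
  have pow: "(\<Sum>i\<in>- {r}. effects \<Lambda> $ i $ u * effects \<Lambda> $ i $ u) = n"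
      "(\<Sum>i\<in>- {r}. effects \<Lambda> $ i $ u * effects \<Lambda> $ i $ u * effects \<Lambda> $ i $ u) = n"
    unfolding n_def using iu by (fastforce intro!: sum.cong)+
  \<comment> \<open>The noise of \<open>u\<close> itself is counted, so \<open>n\<close> is
    positive.\<close>
  have "effects \<Lambda> $ u $ u \<le> n"
    unfolding n_def using iu r(2) by (intro member_le_sum) fastforce+
  then have "1 \<le> n" using uu by simp
  have "d22 \<Lambda> skewed_noise u r = 8 * n"
    by (simp add: d22_eq s_mom_skewed_noise t_mom_skewed_noise sum_UNIV_remove[where r = r] pow ru root)
  with \<open>1 \<le> n\<close> have "d22 \<Lambda> skewed_noise u r \<noteq> 0" by simp
  with \<Lambda> noise_distr_skewed_noise show ?thesis
    unfolding identically_zero_def by blast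
qed

text \<open>By \<open>disj\<close>, only \<open>r\<close> is both an ancestor of \<open>u\<close>
  and on a shortest walk from \<open>r\<close> to \<open>w\<close>. So \<open>r\<close> gives the
  point \<open>(2, 2)\<close>, and all others lie on the axes: \<open>n1\<close> points
  \<open>(1, 0)\<close>, \<open>n2\<close> points \<open>(0, 1)\<close>, the rest at the
  origin.\<close>

lemma d33_not_identically_zero:
  fixes G :: "('v::finite) pair_pre_digraph"
  assumes u: "(r, u) \<in> (parcs G)\<^sup>*" "u \<noteq> r" and w: "(r, w) \<in> (parcs G)\<^sup>*" "w \<noteq> r"
    and disj: "\<And>i m n. (i, u) \<in> (parcs G)\<^sup>* \<Longrightarrow> (r, i) \<in> parcs G ^^ m \<Longrightarrow> (i, w) \<in> parcs G ^^ n \<Longrightarrow>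
      m + n = dist_from (parcs G) r w \<Longrightarrow> i = r"
  shows "\<not> identically_zero G (\<lambda>\<Lambda> \<mu>. d33 \<Lambda> \<mu> u w)"
proof -
  obtain \<Lambda> where \<Lambda>: "\<Lambda> \<in> edge_matrices G"
    and rj: "\<And>j. (r, j) \<in> (parcs G)\<^sup>* \<Longrightarrow> j \<noteq> r \<Longrightarrow> effects \<Lambda> $ r $ j = 2"
    and jj: "\<And>j. (r, j) \<in> (parcs G)\<^sup>* \<Longrightarrow> j \<noteq> r \<Longrightarrow> effects \<Lambda> $ j $ j = 1"
    and ij: "\<And>i j. (r, j) \<in> (parcs G)\<^sup>* \<Longrightarrow> j \<noteq> r \<Longrightarrow> i \<noteq> r \<Longrightarrow> effects \<Lambda> $ i $ j \<in> {0, 1}"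
    and nz: "\<And>i j. (r, j) \<in> (parcs G)\<^sup>* \<Longrightarrow> j \<noteq> r \<Longrightarrow> i \<noteq> r \<Longrightarrow> effects \<Lambda> $ i $ j \<noteq> 0 \<Longrightarrow>
      \<exists>m n. (r, i) \<in> parcs G ^^ m \<and> (i, j) \<in> parcs G ^^ n \<and> m + n = dist_from (parcs G) r j"
    by (rule bfs_tree_effects[where r = r and G = G]) blast
  define x y where "x i = effects \<Lambda> $ i $ u" and "y i = effects \<Lambda> $ i $ w" for i
  have xy0: "x i * y i = 0" if "i \<noteq> r" for i
  proof (rule ccontr)
    assume "x i * y i \<noteq> 0"
    then have "x i \<noteq> 0" "y i \<noteq> 0" by auto
    with nz[OF u that] nz[OF w that] disj[of i] that show False
      unfolding x_def y_def by (meson relpow_imp_rtrancl)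
  qed
  define n1 n2 where "n1 = (\<Sum>i\<in>- {r}. x i)" and "n2 = (\<Sum>i\<in>- {r}. y i)"
  have x01: "x i \<in> {0, 1}" and y01: "y i \<in> {0, 1}" if "i \<noteq> r" for i
    using ij[OF u that] ij[OF w that] by (simp_all add: x_def y_def)
  have sums: "(\<Sum>i\<in>- {r}. x i * x i) = n1" "(\<Sum>i\<in>- {r}. x i * x i * x i) = n1"
      "(\<Sum>i\<in>- {r}. y i * y i) = n2" "(\<Sum>i\<in>- {r}. y i * y i * y i) = n2"
      "(\<Sum>i\<in>- {r}. x i * y i) = 0" "(\<Sum>i\<in>- {r}. x i * x i * y i) = 0"
      "(\<Sum>i\<in>- {r}. x i * y i * y i) = 0"
    unfolding n1_def n2_def using x01 y01 xy0 by (fastforce intro!: sum.cong sum.neutral)+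
  have "x u \<le> n1" "y w \<le> n2"
    unfolding n1_def n2_def using x01 y01 u(2) w(2) by (intro member_le_sum; fastforce)+
  then have "1 \<le> n1" "1 \<le> n2"
    using jj[OF u] jj[OF w] by (simp_all add: x_def y_def)
  have "x r = 2" "y r = 2"
    using rj[OF u] rj[OF w] by (simp_all add: x_def y_def)
  \<comment> \<open>After halving all moments the rows are \<open>(4 + n1, 4, 4 + n2)\<close>,
    \<open>(8 + n1, 8, 8)\<close> and \<open>(8, 8, 8 + n2)\<close>, with determinant
    \<open>12 * (n1 * n2)\<close>; the three rows restore a factor 8.\<close>
  then have "d33 \<Lambda> skewed_noise u w = 96 * (n1 * n2)"
    unfolding d33_eq s_mom_skewed_noise t_mom_skewed_noise x_def [symmetric] y_def [symmetric]
    by (simp add: sum_UNIV_remove[where r = r] sums) (simp add: algebra_simps)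
  with \<open>1 \<le> n1\<close> \<open>1 \<le> n2\<close> have "d33 \<Lambda> skewed_noise u w \<noteq> 0" by simp
  with \<Lambda> noise_distr_skewed_noise show ?thesis
    unfolding identically_zero_def by blast
qed

subsection \<open>Root cycles\<close>

lemma reachable_iff_rtrancl:
  assumes "pverts G = UNIV"
  shows "reachable (with_proj G) u v \<longleftrightarrow> (u, v) \<in> (parcs G)\<^sup>*"
  unfolding reachable_def using assms
  by (auto intro: rtrancl_on_rtranclI rtrancl_consistent_rtrancl_on)

lemma ancestral_rtranclD:
  assumes "pverts G = UNIV" "ancestral G C" "(u, v) \<in> (parcs G)\<^sup>*" "v \<in> C"
  shows "u \<in> C"
  using assms by (auto simp: ancestral_def anc_def reachable_iff_rtrancl)

section \<open>Periodic indexing of a cycle\<close>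

lemma pcas_fst_snd: "pcas u p v \<Longrightarrow> map fst p @ [v] = u # map snd p"
  by (induct p arbitrary: u) auto

lemma pawalk_verts_eq: "pcas u p v \<Longrightarrow> pawalk_verts u p = map fst p @ [v]"
  by (induct p arbitrary: u) auto

text \<open>Reading the tails of the arc list periodically turns walking along the cycle into
  addition of indices, with no special case for the closing arc.\<close>

lemma cycle_indexing:
  assumes "pair_wf_digraph G" "dicycle G p"
  obtains n \<gamma> where "n > 0" and "\<And>k. \<gamma> (k mod n) = \<gamma> k" and "inj_on \<gamma> {..<n}"
    and "set p = (\<lambda>k. (\<gamma> k, \<gamma> (Suc k))) ` {..<n}"
proof -
  interpret pair_wf_digraph G by fact
  define n where "n = length p"
  define \<gamma> where "\<gamma> k = fst (p ! (k mod n))" for k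
  obtain u where u: "awalk u p u" "distinct (tl (pawalk_verts u p))" "p \<noteq> []"
    using assms(2) by (auto simp: cycle_def)
  have n: "n > 0" using u(3) by (simp add: n_def)
  have cas: "pcas u p u"
    using u(1) by (auto simp: awalk_def)
  note rot = pcas_fst_snd[OF cas]
  \<comment> \<open>The library's cycles have distinct heads of arcs. Tails and heads agree as
    multisets, so the tails are distinct too.\<close>
  have "mset (map fst p @ [u]) = mset (u # map snd p)"
    unfolding rot ..
  then have "mset (map fst p) = mset (map snd p)" by simp
  moreover have "distinct (map snd p)"
    using u(2) unfolding pawalk_verts_eq[OF cas] rot by simp
  ultimately have dist: "distinct (map fst p)"
    by (metis mset_eq_imp_distinct_iff)
  have "inj_on \<gamma> {..<n}"
    using dist by (auto simp: inj_on_def \<gamma>_def n_def distinct_conv_nth)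
  moreover have "p ! k = (\<gamma> k, \<gamma> (Suc k))" if "k < n" for k
  proof -
    have "snd (p ! k) = (map fst p @ [u]) ! Suc k"
      unfolding rot using that by (simp add: n_def)
    also have "\<dots> = \<gamma> (Suc k)"
    proof (cases "Suc k < n")
      case True
      then show ?thesis by (simp add: nth_append \<gamma>_def n_def)
    next
      case False
      then have "Suc k = n" using that by simp
      moreover have "u = fst (p ! 0)"
        using rot u(3) by (cases p) auto
      ultimately show ?thesis by (simp add: nth_append \<gamma>_def n_def)
    qed
    finally show ?thesis
      using that by (simp add: \<gamma>_def prod_eq_iff)
  qed
  then have "set p = (\<lambda>k. (\<gamma> k, \<gamma> (Suc k))) ` {..<n}"
    by (force simp: set_conv_nth n_def)
  moreover have "\<gamma> (k mod n) = \<gamma> k" for k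
    by (simp add: \<gamma>_def)
  ultimately show ?thesis
    using that n by blast
qed

section \<open>Arcs and effects along a root cycle\<close>

locale indexed_root_cycle = pair_digraph G
  for G :: "('v::finite) pair_pre_digraph" +
  fixes p :: "('v \<times> 'v) list" and n :: nat and \<gamma> :: "nat \<Rightarrow> 'v"
  assumes verts: "pverts G = UNIV"
    and disjoint: "cycle_disjoint G" and root: "root_cycle G p"
    and n_pos: "n > 0" and \<gamma>_mod: "\<gamma> (k mod n) = \<gamma> k" and inj: "inj_on \<gamma> {..<n}"
    and arcs_cycle: "set p = (\<lambda>k. (\<gamma> k, \<gamma> (Suc k))) ` {..<n}"
begin

abbreviation "C \<equiv> cycle_verts p"
abbreviation "E \<equiv> parcs G"

lemma anc_C: "(u, v) \<in> E\<^sup>* \<Longrightarrow> v \<in> C \<Longrightarrow> u \<in> C"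
  using root verts by (auto simp: root_cycle_def intro: ancestral_rtranclD)

lemma \<gamma>_eq_iff: "\<gamma> a = \<gamma> b \<longleftrightarrow> a mod n = b mod n"
proof
  assume "\<gamma> a = \<gamma> b"
  then have "\<gamma> (a mod n) = \<gamma> (b mod n)" by (simp add: \<gamma>_mod)
  then show "a mod n = b mod n"
    using inj n_pos by (auto simp: inj_on_def)
qed (metis \<gamma>_mod)

lemma arc_in_p: "(\<gamma> k, \<gamma> (Suc k)) \<in> set p"
proof -
  have "(\<gamma> (k mod n), \<gamma> (Suc (k mod n))) \<in> set p"
    using n_pos unfolding arcs_cycle by auto
  moreover have "\<gamma> (Suc (k mod n)) = \<gamma> (Suc k)"
    by (simp add: \<gamma>_eq_iff mod_Suc_eq)
  ultimately show ?thesis by (simp add: \<gamma>_mod)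
qed

lemma arc_\<gamma>: "(\<gamma> k, \<gamma> (Suc k)) \<in> E"
proof -
  have "set p \<subseteq> E"
    using root by (auto simp: root_cycle_def cycle_def awalk_def)
  with arc_in_p show ?thesis by blast
qed

lemma C_eq: "C = \<gamma> ` {..<n}"
  by (auto simp: cycle_verts_def arcs_cycle image_image)

lemma \<gamma>_in_C: "\<gamma> k \<in> C"
  using n_pos unfolding C_eq by (intro image_eqI[of _ _ "k mod n"]) (simp_all add: \<gamma>_mod)

lemma \<gamma>_reach: "(\<gamma> a, \<gamma> (a + m)) \<in> E\<^sup>*"
proof (induction m)
  case (Suc m)
  then show ?case using arc_\<gamma>[of "a + m"] by (simp add: rtrancl.rtrancl_into_rtrancl)
qed simp

lemma C_connected:
  assumes "u \<in> C" "v \<in> C"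
  shows "(u, v) \<in> E\<^sup>*"
proof -
  from assms obtain a b where ab: "u = \<gamma> a" "v = \<gamma> b" "a < n" "b < n"
    by (auto simp: C_eq)
  \<comment> \<open>\<open>n - a\<close> steps lead to index \<open>n\<close>, which is the vertex
    of index 0, and \<open>b\<close> more steps to \<open>v\<close>.\<close>
  have "\<gamma> (a + (n - a + b)) = v"
    using ab by (simp add: \<gamma>_eq_iff)
  then show ?thesis using \<gamma>_reach[of a "n - a + b"] ab by simp
qed

text \<open>A second arc into the cycle would, together with a path back, give a second cycle.\<close>

lemma unique_in_arc:
  assumes "(i, \<gamma> (Suc k)) \<in> E"
  shows "i = \<gamma> k"
proof -
  have "i \<in> C"
    using assms \<gamma>_in_C by (blast intro: anc_C)
  then have "(\<gamma> (Suc k), i) \<in> E\<^sup>*"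
    by (intro C_connected \<gamma>_in_C)
  then obtain q where q: "apath (\<gamma> (Suc k)) q i"
    using reachable_apath reachable_iff_rtrancl[OF verts] by blast
  let ?q = "(i, \<gamma> (Suc k)) # q"
  have "cycle ?q"
    unfolding cycle_def using q assms verts
    by (intro exI[of _ i]) (auto simp: apath_def awalk_Cons_iff)
  moreover have "i \<in> cycle_verts ?q"
    by (simp add: cycle_verts_def)
  \<comment> \<open>Both cycles pass through \<open>i\<close>, so cycle-disjointness makes the new
    arc one of \<open>p\<close>.\<close>
  ultimately have "set ?q = set p"
    using disjoint root \<open>i \<in> C\<close> unfolding cycle_disjoint_def root_cycle_def by blast
  then have "(i, \<gamma> (Suc k)) \<in> set p" by auto
  then obtain l where "i = \<gamma> l" "\<gamma> (Suc k) = \<gamma> (Suc l)"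
    by (auto simp: arcs_cycle)
  moreover from this(2) have "Suc l mod n = Suc k mod n"
    by (simp only: \<gamma>_eq_iff)
  \<comment> \<open>Adding \<open>n - 1\<close> undoes the successor modulo
    \<open>n\<close>.\<close>
  then have "(Suc l + (n - 1)) mod n = (Suc k + (n - 1)) mod n"
    by (rule mod_add_cong) simp
  then have "l mod n = k mod n"
    using n_pos by simp
  ultimately show ?thesis by (simp add: \<gamma>_eq_iff)
qed

text \<open>Each vertex of the cycle has only its cycle predecessor as a possible source of arcs, so
  one step multiplies the column of effects by one arc weight. The exception is the row of the
  vertex just entered, whose own noise joins; hence the excluded indices.\<close>

lemma effects_along_cycle:
  assumes \<Lambda>: "\<Lambda> \<in> edge_matrices G"
  shows "\<exists>c. \<forall>i. i \<notin> \<gamma> ` {a<..a + m} \<longrightarrow> effects \<Lambda> $ i $ \<gamma> (a + m) = c * effects \<Lambda> $ i $ \<gamma> a"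
proof (induction m)
  case 0
  show ?case by (intro exI[of _ 1]) simp
next
  case (Suc m)
  then obtain c where
    c: "\<And>i. i \<notin> \<gamma> ` {a<..a + m} \<Longrightarrow> effects \<Lambda> $ i $ \<gamma> (a + m) = c * effects \<Lambda> $ i $ \<gamma> a"
    by blast
  let ?k = "a + m"
  have "\<Lambda> $ l $ \<gamma> (Suc ?k) = 0" if "l \<noteq> \<gamma> ?k" for l
    using \<Lambda> unique_in_arc[of l ?k] that by (auto simp: edge_matrices_def)
  then have "(\<Sum>l\<in>UNIV. effects \<Lambda> $ i $ l * \<Lambda> $ l $ \<gamma> (Suc ?k))
      = effects \<Lambda> $ i $ \<gamma> ?k * \<Lambda> $ \<gamma> ?k $ \<gamma> (Suc ?k)" for i
    by (subst sum.mono_neutral_right[of UNIV "{\<gamma> ?k}"]) auto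
  then have "effects \<Lambda> $ i $ \<gamma> (Suc ?k) = effects \<Lambda> $ i $ \<gamma> ?k * \<Lambda> $ \<gamma> ?k $ \<gamma> (Suc ?k)"
    if "i \<noteq> \<gamma> (Suc ?k)" for i
    using effects_rec[OF \<Lambda>, of i "\<gamma> (Suc ?k)"] that by simp
  with c show ?case
    by (intro exI[of _ "c * \<Lambda> $ \<gamma> ?k $ \<gamma> (Suc ?k)"]) (auto simp: image_iff)
qed

text \<open>The two vertices cut the cycle into two stretches. A noise term arising in one stretch
  does not arise in the other, so walking along the other scales its effect by a fixed
  constant.\<close>

lemma effects_lines:
  assumes \<Lambda>: "\<Lambda> \<in> edge_matrices G" and "u \<in> C" "v \<in> C"
  shows "\<exists>a b. \<forall>i. effects \<Lambda> $ i $ u = a * effects \<Lambda> $ i $ v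
                 \<or> effects \<Lambda> $ i $ v = b * effects \<Lambda> $ i $ u"
proof -
  have main: "\<exists>\<alpha> \<beta>. \<forall>i. effects \<Lambda> $ i $ \<gamma> a = \<alpha> * effects \<Lambda> $ i $ \<gamma> b
                 \<or> effects \<Lambda> $ i $ \<gamma> b = \<beta> * effects \<Lambda> $ i $ \<gamma> a"
    if ab: "a \<le> b" "b < n" for a b
  proof -
    from effects_along_cycle[OF \<Lambda>, of a "b - a"] ab obtain \<beta> where
      \<beta>: "\<And>i. i \<notin> \<gamma> ` {a<..b} \<Longrightarrow> effects \<Lambda> $ i $ \<gamma> b = \<beta> * effects \<Lambda> $ i $ \<gamma> a"
      by auto
    \<comment> \<open>The way back from \<open>b\<close> to \<open>a\<close> ends at index
      \<open>a + n\<close>, one turn later.\<close>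
    have "\<gamma> (a + n) = \<gamma> a" by (simp add: \<gamma>_eq_iff)
    with effects_along_cycle[OF \<Lambda>, of b "a + n - b"] ab obtain \<alpha> where
      \<alpha>: "\<And>i. i \<notin> \<gamma> ` {b<..a + n} \<Longrightarrow> effects \<Lambda> $ i $ \<gamma> a = \<alpha> * effects \<Lambda> $ i $ \<gamma> b"
      by auto
    have "\<gamma> ` {a<..b} \<inter> \<gamma> ` {b<..a + n} = {}"
    proof (rule ccontr)
      assume "\<gamma> ` {a<..b} \<inter> \<gamma> ` {b<..a + n} \<noteq> {}"
      then obtain k l where kl: "k \<in> {a<..b}" "l \<in> {b<..a + n}" and "\<gamma> k = \<gamma> l"
        by blast
      \<comment> \<open>Both indices lie in \<open>{a<..a + n}\<close>, a single period, and
        \<open>k < l\<close>, so they cannot agree modulo \<open>n\<close>.\<close>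
      then have "n dvd l - k"
        using mod_eq_dvd_iff_nat[of k l n] by (auto simp: \<gamma>_eq_iff)
      moreover have "0 < l - k" "l - k < n" using kl by auto
      ultimately show False by (auto dest: dvd_imp_le)
    qed
    then show ?thesis using \<alpha> \<beta> by blast
  qed
  from assms obtain a b where "u = \<gamma> a" "v = \<gamma> b" "a < n" "b < n"
    by (auto simp: C_eq)
  moreover have "a \<le> b \<or> b \<le> a" by linarith
  ultimately show ?thesis
    using main[of a b] main[of b a] by blast
qed

section \<open>Admissibility and maximality of a root cycle\<close>

lemma admissible_C: "admissible G C"
  unfolding admissible_def
proof (intro ballI impI conjI)
  fix u v assume uv: "u \<in> C" "v \<in> C" "u \<noteq> v"
  show "identically_zero G (\<lambda>\<Lambda> \<mu>. d33 \<Lambda> \<mu> u v)"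
    unfolding identically_zero_def using effects_lines[OF _ uv(1,2)] d33_eq_zero by blast
  show "\<not> identically_zero G (\<lambda>\<Lambda> \<mu>. d22 \<Lambda> \<mu> u v)"
    using uv C_connected by (intro d22_not_identically_zero) auto
qed

lemma maximal_C:
  assumes D: "admissible G D" "C \<subseteq> D"
  shows "D = C"
proof (rule ccontr)
  assume "D \<noteq> C"
  with D obtain w where w: "w \<in> D" "w \<notin> C" by blast
  show False
  proof (cases "\<exists>c\<in>C. (c, w) \<in> E\<^sup>*")
    case False
    \<comment> \<open>\<open>\<gamma> 0\<close> stands for any vertex of the cycle. Noise arising in
      \<open>C\<close> does not reach \<open>w\<close>, and noise arising outside the ancestral set
      \<open>C\<close> does not reach \<open>\<gamma> 0\<close>.\<close>
    have "d22 \<Lambda> \<mu> (\<gamma> 0) w = 0" if \<Lambda>: "\<Lambda> \<in> edge_matrices G" and \<mu>: "noise_distr \<mu>" for \<Lambda> \<mu>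
    proof (rule d22_eq_zero[OF \<mu>])
      fix i
      show "effects \<Lambda> $ i $ \<gamma> 0 = 0 \<or> effects \<Lambda> $ i $ w = 0"
      proof (cases "i \<in> C")
        case True
        with False have "i \<notin> {i. (i, w) \<in> E\<^sup>*}" by blast
        then have "effects \<Lambda> $ i $ w = 0"
          using effects_eq_zero[OF \<Lambda>, of "{i. (i, w) \<in> E\<^sup>*}" w i]
          by (auto intro: converse_rtrancl_into_rtrancl)
        then show ?thesis ..
      next
        case False
        then have "effects \<Lambda> $ i $ \<gamma> 0 = 0"
          using effects_eq_zero[OF \<Lambda>, of C] anc_C \<gamma>_in_C by blast
        then show ?thesis ..
      qed
    qed
    moreover have "\<gamma> 0 \<in> D" "\<gamma> 0 \<noteq> w"
      using D(2) \<gamma>_in_C w by auto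
    ultimately show False
      using D(1) w(1) unfolding admissible_def identically_zero_def by blast
  next
    case True
    then obtain r where r: "r \<in> C" "(r, w) \<in> E\<^sup>*"
      and min: "\<And>c. c \<in> C \<Longrightarrow> (c, w) \<in> E\<^sup>* \<Longrightarrow> dist_from E r w \<le> dist_from E c w"
      using ex_has_least_nat[of "\<lambda>c. c \<in> C \<and> (c, w) \<in> E\<^sup>*" _ "\<lambda>c. dist_from E c w"] by blast
    \<comment> \<open>Without loops, \<open>\<gamma> 0\<close> and \<open>\<gamma> 1\<close> differ,
      so one of them is not \<open>r\<close>.\<close>
    obtain u where u: "u \<in> C" "u \<noteq> r"
      using \<gamma>_in_C[of 0] \<gamma>_in_C[of 1] no_loops'[OF arc_\<gamma>[of 0]] by (metis One_nat_def)
    have "\<not> identically_zero G (\<lambda>\<Lambda> \<mu>. d33 \<Lambda> \<mu> u w)"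
    proof (rule d33_not_identically_zero)
      show "(r, u) \<in> E\<^sup>*" using r u by (intro C_connected)
      fix i m n
      assume i: "(i, u) \<in> E\<^sup>*" "(r, i) \<in> E ^^ m" "(i, w) \<in> E ^^ n" "m + n = dist_from E r w"
      \<comment> \<open>As an ancestor of \<open>u\<close>, the vertex \<open>i\<close> lies in
        \<open>C\<close> and is no closer to \<open>w\<close> than \<open>r\<close>. A shortest walk
        from \<open>r\<close> to \<open>w\<close> through \<open>i\<close> must therefore start at
        \<open>i\<close>.\<close>
      then have "dist_from E r w \<le> dist_from E i w"
        using u by (intro min) (auto intro: anc_C relpow_imp_rtrancl)
      also have "\<dots> \<le> n" using i by (intro dist_from_le)
      finally have "m = 0" using i by simp
      then show "i = r" using i by simp
    qed (use u r w in auto)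
    moreover have "u \<in> D" "u \<noteq> w" using u w D by auto
    ultimately show False
      using D(1) w(1) unfolding admissible_def by blast
  qed
qed

end

theorem corollary4p5:
  fixes G :: "('v::finite) pair_pre_digraph"
  assumes "pair_digraph G"
    and "pverts G = UNIV"
    and "cycle_disjoint G"
  shows "{cycle_verts p | p. root_cycle G p} \<subseteq> max_admissible G"
proof clarify
  fix p assume p: "root_cycle G p"
  interpret pair_digraph G by fact
  have "dicycle G p" using p by (simp add: root_cycle_def)
  with pair_wf_digraph obtain n \<gamma> where "n > 0" "\<And>k. \<gamma> (k mod n) = \<gamma> k" "inj_on \<gamma> {..<n}"
      "set p = (\<lambda>k. (\<gamma> k, \<gamma> (Suc k))) ` {..<n}"
    by (rule cycle_indexing) blast
  with assms p interpret indexed_root_cycle G p n \<gamma>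
    by unfold_locales
  show "cycle_verts p \<in> max_admissible G"
    using admissible_C maximal_C by (auto simp: max_admissible_def)
qed

end
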